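(* The MBnB complexity $S$ of the subset sum problem satisfies the following upper bounds: $S \leq 2\binom{n+1}{t} - 1$ if $t \le \lfloor n/2\rfloor + 1$, and $S \leq 2\left(\binom{n+1}{\lfloor n/2\rfloor+1} - \binom{t}{\lfloor n/2\rfloor+1}\right) + 1$ if $t > \lfloor n/2\rfloor + 1$, where $t = \min\{k \in N : \sum_{i=n-k+1}^{n} w_i > C\}$.
   Context: Consider the subset sum problem: maximize $f(x)=\sum_{i\in N} w_i x_i$ subject to $\sum_{i\in N} w_i x_i \le C$, $x_i\in\{0,1\}$, where $N=\{1,\dots,n\}$ and the capacity $C$ and weights $w_i$ are positive integers; the variables are ordered so that $w_1\ge w_2\ge\dots\ge w_n$. Let $W=\sum_{i\in N} w_i$. A subproblem is given by a set $I\subseteq N$ of fixed variables with fixed values $\theta(i)\in\{0,1\}$, $i\in I$, the remaining variables being free. It satisfies the C0-condition if $\sum_{i\in I}\theta(i)w_i > C$, and the C1-condition if $\sum_{i\in I}(1-\theta(i))w_i \ge W-C$. The majoritarian Branch-and-Bound (MBnB) algorithm starts with the list containing the original problem and repeatedly removes a subproblem from the list: if it satisfies the C0-condition it is discarded; if it satisfies the C1-condition, the solution setting all free variables to 1 is compared with the incumbent; otherwise the subproblem is split into the two subproblems obtained by fixing the free variable of maximal weight to 0 and to 1, which are added to the list. The algorithm stops when the list is empty. The MBnB complexity of the problem is the number of iterations of this main loop, i.e. the total number of nodes in the resulting MBnB tree. *)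

theory Defs
  imports Complex_Main "HOL-Library.Multiset"
begin

text \<open>An instance consists of the number \<open>n\<close> of variables, the weights \<open>w\<close> (relevant on
  \<open>{1..n}\<close>) and the capacity \<open>C\<close>. A subproblem is a pair \<open>(I, \<theta>)\<close> of a set of fixed
  variables and their values; the values of \<open>\<theta>\<close> outside \<open>I\<close> are irrelevant. Weights are
  integers rather than naturals so that \<open>W - C\<close> is not truncated.\<close>

type_synonym subproblem = "nat set \<times> (nat \<Rightarrow> int)"

definition C0_condition :: "(nat \<Rightarrow> int) \<Rightarrow> int \<Rightarrow> subproblem \<Rightarrow> bool" where
  "C0_condition w C = (\<lambda>(I, \<theta>). (\<Sum>i\<in>I. \<theta> i * w i) > C)"

definition C1_condition :: "nat \<Rightarrow> (nat \<Rightarrow> int) \<Rightarrow> int \<Rightarrow> subproblem \<Rightarrow> bool" where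
  "C1_condition n w C = (\<lambda>(I, \<theta>). (\<Sum>i\<in>I. (1 - \<theta> i) * w i) \<ge> (\<Sum>i=1..n. w i) - C)"

definition objective :: "nat \<Rightarrow> (nat \<Rightarrow> int) \<Rightarrow> (nat \<Rightarrow> int) \<Rightarrow> int" where
  "objective n w x = (\<Sum>i=1..n. w i * x i)"

definition complete_with_ones :: "subproblem \<Rightarrow> nat \<Rightarrow> int" where
  "complete_with_ones = (\<lambda>(I, \<theta>) i. if i \<in> I then \<theta> i else 1)"

definition update_incumbent ::
  "nat \<Rightarrow> (nat \<Rightarrow> int) \<Rightarrow> (nat \<Rightarrow> int) \<Rightarrow> (nat \<Rightarrow> int) option \<Rightarrow> (nat \<Rightarrow> int) option" where
  "update_incumbent n w x inc = (case inc of
     None \<Rightarrow> Some x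
   | Some y \<Rightarrow> if objective n w x > objective n w y then Some x else Some y)"

definition is_branching_variable :: "nat \<Rightarrow> (nat \<Rightarrow> int) \<Rightarrow> nat set \<Rightarrow> nat \<Rightarrow> bool" where
  "is_branching_variable n w I i \<longleftrightarrow> i \<in> {1..n} - I \<and> (\<forall>j\<in>{1..n} - I. w j \<le> w i)"

text \<open>A state is the list of open subproblems, as a multiset because the order of processing is
  left open, together with the incumbent. Ties between free variables of maximal weight may be
  broken arbitrarily.\<close>

type_synonym mbnb_state = "subproblem multiset \<times> (nat \<Rightarrow> int) option"

inductive mbnb_step :: "nat \<Rightarrow> (nat \<Rightarrow> int) \<Rightarrow> int \<Rightarrow> mbnb_state \<Rightarrow> mbnb_state \<Rightarrow> bool"
  for n w C where
  discard: "C0_condition w C P \<Longrightarrow> mbnb_step n w C (add_mset P L, inc) (L, inc)"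
| compare: "\<not> C0_condition w C P \<Longrightarrow> C1_condition n w C P \<Longrightarrow>
    mbnb_step n w C (add_mset P L, inc) (L, update_incumbent n w (complete_with_ones P) inc)"
| split: "\<not> C0_condition w C (I, \<theta>) \<Longrightarrow> \<not> C1_condition n w C (I, \<theta>) \<Longrightarrow>
    is_branching_variable n w I i \<Longrightarrow>
    mbnb_step n w C (add_mset (I, \<theta>) L, inc)
      (add_mset (insert i I, \<theta>(i := 0)) (add_mset (insert i I, \<theta>(i := 1)) L), inc)"

definition mbnb_terminates_after :: "nat \<Rightarrow> (nat \<Rightarrow> int) \<Rightarrow> int \<Rightarrow> nat \<Rightarrow> bool" where
  "mbnb_terminates_after n w C S \<longleftrightarrow>
     (\<exists>inc. (mbnb_step n w C ^^ S) ({#({}, \<lambda>_. 0)#}, None) ({#}, inc))"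

text \<open>All runs have the same length, so this is well defined; see
  \<open>mbnb_terminates_after_iff\<close> below.\<close>

definition mbnb_complexity :: "nat \<Rightarrow> (nat \<Rightarrow> int) \<Rightarrow> int \<Rightarrow> nat" where
  "mbnb_complexity n w C = (THE S. mbnb_terminates_after n w C S)"

definition mbnb_t :: "nat \<Rightarrow> (nat \<Rightarrow> int) \<Rightarrow> int \<Rightarrow> nat" where
  "mbnb_t n w C = Min {k \<in> {1..n}. (\<Sum>i=n-k+1..n. w i) > C}"

text \<open>To prove that all runs have the same length, we count the nodes of the tree recursively. The
  list contains the negated weights of the free variables in increasing order.\<close>

fun node_count :: "int \<Rightarrow> int \<Rightarrow> int list \<Rightarrow> int \<Rightarrow> int \<Rightarrow> nat" where
  "node_count C D [] a b = 1"
| "node_count C D (v # vs) a b = (if a > C \<or> b \<ge> D then 1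
     else 1 + node_count C D vs a (b - v) + node_count C D vs (a - v) b)"

definition subproblem_nodes :: "nat \<Rightarrow> (nat \<Rightarrow> int) \<Rightarrow> int \<Rightarrow> subproblem \<Rightarrow> nat" where
  "subproblem_nodes n w C = (\<lambda>(I, \<theta>). node_count C ((\<Sum>i=1..n. w i) - C)
     (sorted_list_of_multiset (image_mset (\<lambda>i. - w i) (mset_set ({1..n} - I))))
     (\<Sum>i\<in>I. \<theta> i * w i) (\<Sum>i\<in>I. (1 - \<theta> i) * w i))"

lemma node_count_pos: "node_count C D vs a b > 0"
  by (cases vs) auto

lemma node_count_leaf: "a > C \<or> b \<ge> D \<Longrightarrow> node_count C D vs a b = 1"
  by (cases vs) auto

lemma subproblem_nodes_leaf:
  "C0_condition w C P \<or> C1_condition n w C P \<Longrightarrow> subproblem_nodes n w C P = 1"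
  by (cases P) (auto simp: C0_condition_def C1_condition_def subproblem_nodes_def node_count_leaf)

lemma subproblem_nodes_split:
  assumes "\<not> C0_condition w C (I, \<theta>)" "\<not> C1_condition n w C (I, \<theta>)"
    and i: "is_branching_variable n w I i" and I: "I \<subseteq> {1..n}"
  shows "subproblem_nodes n w C (I, \<theta>) = 1 + subproblem_nodes n w C (insert i I, \<theta>(i := 0))
    + subproblem_nodes n w C (insert i I, \<theta>(i := 1))"
proof -
  let ?F = "{1..n} - insert i I"
  have fin: "finite I" using I finite_subset by blast
  have iI: "i \<notin> I" and mx: "\<And>j. j \<in> {1..n} - I \<Longrightarrow> w j \<le> w i"
    using i by (auto simp: is_branching_variable_def)
  have "mset_set (insert i ?F) = add_mset i (mset_set ?F)"
    by (rule mset_set.insert) auto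
  moreover have "insert i ?F = {1..n} - I" using i by (auto simp: is_branching_variable_def)
  ultimately have "mset_set ({1..n} - I) = add_mset i (mset_set ?F)" by metis
  then have L: "sorted_list_of_multiset (image_mset (\<lambda>i. - w i) (mset_set ({1..n} - I)))
      = - w i # sorted_list_of_multiset (image_mset (\<lambda>i. - w i) (mset_set ?F))"
    using mx by (simp add: insort_is_Cons del: Diff_insert)
  define A where "A = (\<Sum>j\<in>I. \<theta> j * w j)"
  define B where "B = (\<Sum>j\<in>I. (1 - \<theta> j) * w j)"
  have upd: "(\<Sum>j\<in>I. (\<theta>(i := c)) j * w j) = A"
    "(\<Sum>j\<in>I. (1 - (\<theta>(i := c)) j) * w j) = B" for c
    unfolding A_def B_def using iI by (auto intro!: sum.cong)
  have s: "(\<Sum>j\<in>insert i I. (\<theta>(i := c)) j * w j) = c * w i + A"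
    "(\<Sum>j\<in>insert i I. (1 - (\<theta>(i := c)) j) * w j) = (1 - c) * w i + B" for c
    unfolding sum.insert[OF fin iI] upd by simp_all
  have leaf: "\<not> (A > C \<or> B \<ge> (\<Sum>i=1..n. w i) - C)"
    using assms(1,2) by (simp add: C0_condition_def C1_condition_def A_def B_def)
  show ?thesis
    unfolding subproblem_nodes_def prod.case L s A_def[symmetric] B_def[symmetric]
      node_count.simps if_not_P[OF leaf]
    by (simp add: add.commute)
qed

definition wf_list :: "nat \<Rightarrow> subproblem multiset \<Rightarrow> bool" where
  "wf_list n L \<longleftrightarrow> (\<forall>P\<in>#L. fst P \<subseteq> {1..n})"

definition list_nodes :: "nat \<Rightarrow> (nat \<Rightarrow> int) \<Rightarrow> int \<Rightarrow> subproblem multiset \<Rightarrow> nat" where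
  "list_nodes n w C L = (\<Sum>P\<in>#L. subproblem_nodes n w C P)"

lemma mbnb_step_invariant:
  assumes "mbnb_step n w C s s'" "wf_list n (fst s)"
  shows "wf_list n (fst s') \<and> list_nodes n w C (fst s) = Suc (list_nodes n w C (fst s'))"
  using assms
proof (cases rule: mbnb_step.cases)
  case (split I \<theta> i L inc)
  then show ?thesis
    using assms(2) subproblem_nodes_split[of w C I \<theta> n i]
    by (auto simp: wf_list_def list_nodes_def is_branching_variable_def)
qed (use assms(2) in \<open>auto simp: wf_list_def list_nodes_def subproblem_nodes_leaf\<close>)

lemma mbnb_step_exists:
  assumes "wf_list n L" "L \<noteq> {#}"
  shows "\<exists>s'. mbnb_step n w C (L, inc) s'"
proof -
  obtain I \<theta> L' where L: "L = add_mset (I, \<theta>) L'"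
    using assms(2) by (metis multiset_nonemptyE mset_add surj_pair)
  have I: "I \<subseteq> {1..n}" using assms(1) by (auto simp: wf_list_def L)
  show ?thesis
  proof (cases "C0_condition w C (I, \<theta>) \<or> C1_condition n w C (I, \<theta>)")
    case True
    then show ?thesis unfolding L by (metis discard compare)
  next
    case False
    have "{1..n} - I \<noteq> {}"
    proof
      assume "{1..n} - I = {}"
      then have "I = {1..n}" using I by auto
      moreover have "(\<Sum>i\<in>I. \<theta> i * w i) + (\<Sum>i\<in>I. (1 - \<theta> i) * w i) = (\<Sum>i\<in>I. w i)"
        by (simp add: sum.distrib[symmetric] algebra_simps)
      ultimately show False using False
        by (auto simp: C0_condition_def C1_condition_def)
    qed
    then have "Max (w ` ({1..n} - I)) \<in> w ` ({1..n} - I)" by (intro Max_in) auto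
    then obtain i where i: "i \<in> {1..n} - I" "w i = Max (w ` ({1..n} - I))" by auto
    then have "is_branching_variable n w I i"
      by (simp add: is_branching_variable_def)
    then show ?thesis using False unfolding L by (blast intro: split)
  qed
qed

lemma list_nodes_eq_0_iff: "list_nodes n w C L = 0 \<longleftrightarrow> L = {#}"
proof (cases L)
  case (add P L')
  then show ?thesis
    using node_count_pos by (cases P) (auto simp: list_nodes_def subproblem_nodes_def)
qed (simp add: list_nodes_def)

lemma mbnb_run_length:
  "(mbnb_step n w C ^^ S) s ({#}, inc) \<Longrightarrow> wf_list n (fst s) \<Longrightarrow> S = list_nodes n w C (fst s)"
proof (induction S arbitrary: s)
  case 0
  then show ?case by (auto simp: list_nodes_def)
next
  case (Suc S)
  then obtain s' where "mbnb_step n w C s s'" "(mbnb_step n w C ^^ S) s' ({#}, inc)"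
    by (meson relpowp_Suc_D2)
  then show ?case using Suc mbnb_step_invariant by metis
qed

lemma mbnb_run_exists:
  "wf_list n (fst s) \<Longrightarrow> list_nodes n w C (fst s) = S \<Longrightarrow>
    \<exists>inc. (mbnb_step n w C ^^ S) s ({#}, inc)"
proof (induction S arbitrary: s)
  case 0
  then show ?case by (cases s) (auto simp: list_nodes_eq_0_iff)
next
  case (Suc S)
  then have "fst s \<noteq> {#}" by (metis list_nodes_eq_0_iff nat.distinct(1))
  then obtain s' where s': "mbnb_step n w C s s'"
    using mbnb_step_exists Suc.prems(1) by (metis prod.collapse)
  then obtain inc where "(mbnb_step n w C ^^ S) s' ({#}, inc)"
    using Suc mbnb_step_invariant[OF s'] by fastforce
  then show ?case using s' by (meson relpowp_Suc_I2)
qed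

theorem mbnb_terminates_after_iff:
  "mbnb_terminates_after n w C S \<longleftrightarrow> S = mbnb_complexity n w C"
proof -
  let ?s = "({#({}, \<lambda>_. 0)#}, None) :: mbnb_state"
  have wf: "wf_list n (fst ?s)" by (simp add: wf_list_def)
  have iff: "mbnb_terminates_after n w C S \<longleftrightarrow> S = list_nodes n w C (fst ?s)" for S
    using mbnb_run_length[OF _ wf] mbnb_run_exists[OF wf] unfolding mbnb_terminates_after_def
    by blast
  show ?thesis unfolding mbnb_complexity_def iff by simp
qed

end

theory Submission
  imports Defs
begin

text \<open>A leaf of the tree is determined by a minimal infeasible set \<open>A\<close> (the ones of a C0-leaf) or
  by a maximal feasible set \<open>B\<close> (the completed solution of a C1-leaf). Because all weights are
  positive, the sets \<open>A\<close> and \<open>B \<union> {n + 1}\<close> form an antichain of subsets of \<open>{1..n + 1}\<close>, and they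
  have at most \<open>t\<close> elements. If \<open>t \<le> n div 2 + 1\<close>, Sperner's argument of replacing the lowest level
  of an antichain by its upper shadow moves the antichain into level \<open>t\<close>. Otherwise let
  \<open>T = {n - t + 2..n + 1}\<close>, so \<open>card T = t\<close>. The \<open>t - 1\<close> smallest weights are jointly feasible, so no
  member of the antichain other than \<open>T\<close> itself is a subset of \<open>T\<close>. The sets not contained in
  \<open>T\<close> are an up-set in which the antichain can still be moved, from both sides, into level
  \<open>n div 2 + 1\<close>. As \<open>S = 2 L - 1\<close> for \<open>L\<close> leaves, this gives the bounds.\<close>

section \<open>Moving antichains between levels\<close>

text \<open>The order is a parameter so that one pushing lemma serves both inclusion and reverse
  inclusion.\<close>

definition antichain_wrt :: "('a \<Rightarrow> 'a \<Rightarrow> bool) \<Rightarrow> 'a set \<Rightarrow> bool" where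
  "antichain_wrt le G \<longleftrightarrow> (\<forall>X\<in>G. \<forall>Y\<in>G. le X Y \<longrightarrow> X = Y)"

text \<open>Double counting of the pairs related by \<open>R\<close>: there are at least
  \<open>d * card A\<close> and at most \<open>d * card B\<close> of them.\<close>

lemma card_le_of_degrees:
  assumes "finite A" "finite B" "d > 0"
    and "\<And>a. a \<in> A \<Longrightarrow> d \<le> card {b \<in> B. R a b}"
    and "\<And>b. b \<in> B \<Longrightarrow> card {a \<in> A. R a b} \<le> d"
  shows "card A \<le> card B"
proof -
  have "d * card A \<le> (\<Sum>a\<in>A. card {b \<in> B. R a b})"
    using sum_bounded_below[of A d "\<lambda>a. card {b \<in> B. R a b}"] assms(4) by (simp add: mult.commute)
  also have "\<dots> = (\<Sum>b\<in>B. card {a \<in> A. R a b})"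
    by (rule sum_multicount_gen[OF assms(1,2)]) simp
  also have "\<dots> \<le> d * card B"
    using sum_bounded_above[of B "\<lambda>b. card {a \<in> A. R a b}" d] assms(5) by (simp add: mult.commute)
  finally show ?thesis using assms(3) by simp
qed

text \<open>The lowest level \<open>F\<close> of \<open>G\<close> is exchanged for its upper shadow
  \<open>U\<close>. By the degree bounds \<open>U\<close> is no smaller than \<open>F\<close>. An
  element of \<open>U\<close> below some remaining \<open>Y\<close> would put an element of
  \<open>F\<close> below \<open>Y\<close>, so the result is again an antichain.\<close>

lemma antichain_push_level:
  fixes rk :: "'a \<Rightarrow> nat"
  assumes P: "finite P"
    and trans: "\<And>X Y Z. le X Y \<Longrightarrow> le Y Z \<Longrightarrow> le X Z"
    and mono: "\<And>X Y. X \<in> P \<Longrightarrow> Y \<in> P \<Longrightarrow> le X Y \<Longrightarrow> X \<noteq> Y \<Longrightarrow> rk X < rk Y"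
    and d: "d > 0"
    and up: "\<And>X. X \<in> P \<Longrightarrow> rk X = k \<Longrightarrow> d \<le> card {Y \<in> P. le X Y \<and> rk Y = Suc k}"
    and down: "\<And>Y. Y \<in> P \<Longrightarrow> rk Y = Suc k \<Longrightarrow> card {X \<in> P. le X Y \<and> rk X = k} \<le> d"
    and G: "G \<subseteq> P" "antichain_wrt le G" "\<And>X. X \<in> G \<Longrightarrow> k \<le> rk X"
  shows "\<exists>G'. G' \<subseteq> P \<and> antichain_wrt le G' \<and> card G \<le> card G' \<and>
    (\<forall>X\<in>G'. Suc k \<le> rk X \<and> (rk X = Suc k \<or> X \<in> G))"
proof -
  define F where "F = {X \<in> G. rk X = k}"
  define U where "U = {Y \<in> P. rk Y = Suc k \<and> (\<exists>X\<in>F. le X Y)}"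
  have "finite G" using finite_subset[OF G(1) P] .
  then have fin: "finite F" "finite U" "finite G" using P by (auto simp: F_def U_def)
  have "card F \<le> card U"
  proof (rule card_le_of_degrees[OF fin(1,2) d, of le])
    fix X assume X: "X \<in> F"
    have "{Y \<in> U. le X Y} = {Y \<in> P. le X Y \<and> rk Y = Suc k}"
      using X unfolding U_def by blast
    then show "d \<le> card {Y \<in> U. le X Y}" using up[of X] X G(1) by (auto simp: F_def)
  next
    fix Y assume Y: "Y \<in> U"
    have "card {X \<in> F. le X Y} \<le> card {X \<in> P. le X Y \<and> rk X = k}"
      by (rule card_mono) (use P G(1) in \<open>auto simp: F_def\<close>)
    then show "card {X \<in> F. le X Y} \<le> d" using down[of Y] Y by (auto simp: U_def)
  qed
  have no: "\<not> le X Y" if X: "X \<in> U" and Y: "Y \<in> G - F" for X Y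
  proof
    assume "le X Y"
    obtain Z where "Z \<in> F" "le Z X" using X unfolding U_def by blast
    then have "le Z Y" "Z \<in> G" using trans[OF _ \<open>le X Y\<close>] by (auto simp: F_def)
    then have "Z = Y" using G(2) Y unfolding antichain_wrt_def by blast
    then show False using \<open>Z \<in> F\<close> Y by blast
  qed
  have rkU: "rk X = Suc k" "X \<in> P" if "X \<in> U" for X using that unfolding U_def by auto
  have rkG: "Suc k \<le> rk X" "X \<in> P" if "X \<in> G - F" for X
    using that G(1) G(3)[of X] by (auto simp: F_def)
  \<comment> \<open>A strict \<open>le Y X\<close> would force \<open>rk Y < Suc k\<close>, but only
    level \<open>k\<close> has been removed from \<open>G\<close>.\<close>
  have no': "\<not> le Y X" if X: "X \<in> U" and Y: "Y \<in> G - F" for X Y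
  proof
    assume le: "le Y X"
    have "Y = X" using mono[OF _ _ le] rkU[OF X] rkG[OF Y] by fastforce
    then show False using le no[OF X Y] by simp
  qed
  have disj: "U \<inter> (G - F) = {}"
  proof (rule ccontr)
    assume "U \<inter> (G - F) \<noteq> {}"
    then obtain X where X: "X \<in> U" "X \<in> G - F" by blast
    then obtain Z where Z: "Z \<in> F" "le Z X" unfolding U_def by blast
    then have "Z = X" using G(2) X(2) unfolding antichain_wrt_def F_def by blast
    then show False using X Z by blast
  qed
  have "antichain_wrt le (U \<union> (G - F))"
    unfolding antichain_wrt_def
  proof (intro ballI impI)
    fix X Y assume X: "X \<in> U \<union> (G - F)" and Y: "Y \<in> U \<union> (G - F)" and le: "le X Y"
    consider "X \<in> U" "Y \<in> U" | "X \<in> G - F" "Y \<in> G - F" using X Y le no no' by blast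
    then show "X = Y"
    proof cases
      case 1
      then show ?thesis using mono[OF _ _ le] rkU by fastforce
    next
      case 2
      then show ?thesis using G(2) le unfolding antichain_wrt_def by blast
    qed
  qed
  moreover have "card G \<le> card (U \<union> (G - F))"
  proof -
    have "card G = card F + card (G - F)"
      using fin card_Un_disjoint[of F "G - F"] by (simp add: F_def Un_absorb1)
    then show ?thesis using \<open>card F \<le> card U\<close> card_Un_disjoint[OF _ _ disj] fin by simp
  qed
  ultimately show ?thesis
    using rkU rkG by (intro exI[of _ "U \<union> (G - F)"]) auto
qed

text \<open>The single-level step is iterated from rank 0 to \<open>m\<close>. The last clause
  records that no new element has rank above \<open>m\<close>, so upper bounds on the ranks in
  \<open>G\<close> carry over.\<close>

lemma antichain_push:
  fixes rk :: "'a \<Rightarrow> nat"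
  assumes "finite P"
    and "\<And>X Y Z. le X Y \<Longrightarrow> le Y Z \<Longrightarrow> le X Z"
    and "\<And>X Y. X \<in> P \<Longrightarrow> Y \<in> P \<Longrightarrow> le X Y \<Longrightarrow> X \<noteq> Y \<Longrightarrow> rk X < rk Y"
    and "\<And>k. k < m \<Longrightarrow> d k > 0"
    and "\<And>X. X \<in> P \<Longrightarrow> rk X < m \<Longrightarrow> d (rk X) \<le> card {Y \<in> P. le X Y \<and> rk Y = Suc (rk X)}"
    and "\<And>k Y. k < m \<Longrightarrow> Y \<in> P \<Longrightarrow> rk Y = Suc k \<Longrightarrow> card {X \<in> P. le X Y \<and> rk X = k} \<le> d k"
    and "G \<subseteq> P" "antichain_wrt le G"
  shows "\<exists>G'. G' \<subseteq> P \<and> antichain_wrt le G' \<and> card G \<le> card G' \<and>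
    (\<forall>X\<in>G'. m \<le> rk X \<and> (rk X = m \<or> X \<in> G))"
proof -
  have "j \<le> m \<Longrightarrow> \<exists>G'. G' \<subseteq> P \<and> antichain_wrt le G' \<and> card G \<le> card G' \<and>
    (\<forall>X\<in>G'. j \<le> rk X \<and> (rk X = j \<or> X \<in> G))" for j
  proof (induction j)
    case 0
    then show ?case using assms(7,8) by (intro exI[of _ G]) auto
  next
    case (Suc j)
    then obtain H where H: "H \<subseteq> P" "antichain_wrt le H" "card G \<le> card H"
      "\<And>X. X \<in> H \<Longrightarrow> j \<le> rk X" "\<And>X. X \<in> H \<Longrightarrow> rk X = j \<or> X \<in> G" by auto
    have "\<exists>G'. G' \<subseteq> P \<and> antichain_wrt le G' \<and> card H \<le> card G' \<and>
      (\<forall>X\<in>G'. Suc j \<le> rk X \<and> (rk X = Suc j \<or> X \<in> H))"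
      by (rule antichain_push_level[where d = "d j"])
        (use assms(1-6) Suc.prems H in \<open>auto simp: Suc_le_eq\<close>)
    then obtain G' where G': "G' \<subseteq> P" "antichain_wrt le G'" "card H \<le> card G'"
      "\<And>X. X \<in> G' \<Longrightarrow> Suc j \<le> rk X" "\<And>X. X \<in> G' \<Longrightarrow> rk X = Suc j \<or> X \<in> H" by auto
    have "rk X = Suc j \<or> X \<in> G" if "X \<in> G'" for X
      using G'(4,5)[OF that] H(5)[of X] by auto
    then show ?case using G' H(3) by (intro exI[of _ G']) auto
  qed
  then show ?thesis by blast
qed

section \<open>Covers in the lattice of subsets\<close>

lemma card_upper_covers:
  assumes "finite V" "X \<subseteq> V"
  shows "card {Y. Y \<subseteq> V \<and> X \<subseteq> Y \<and> card Y = Suc (card X)} = card V - card X"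
proof -
  have finX: "finite X" using assms finite_subset by blast
  have "{Y. Y \<subseteq> V \<and> X \<subseteq> Y \<and> card Y = Suc (card X)} = (\<lambda>x. insert x X) ` (V - X)"
  proof (intro equalityI subsetI)
    fix Y assume Y: "Y \<in> {Y. Y \<subseteq> V \<and> X \<subseteq> Y \<and> card Y = Suc (card X)}"
    then have "card (Y - X) = 1" using finX by (simp add: card_Diff_subset)
    then obtain x where "Y - X = {x}" by (auto simp: card_1_singleton_iff)
    then show "Y \<in> (\<lambda>x. insert x X) ` (V - X)" using Y by (intro image_eqI[of _ _ x]) auto
  qed (use assms finX in auto)
  moreover have "inj_on (\<lambda>x. insert x X) (V - X)" by (auto simp: inj_on_def)
  ultimately show ?thesis using assms finX by (simp add: card_image card_Diff_subset)
qed

lemma lower_covers_eq: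
  assumes "finite Y"
  shows "{X. X \<subseteq> Y \<and> Suc (card X) = card Y} = (\<lambda>y. Y - {y}) ` Y"
proof (intro equalityI subsetI)
  fix X assume "X \<in> {X. X \<subseteq> Y \<and> Suc (card X) = card Y}"
  then have X: "X \<subseteq> Y" "Suc (card X) = card Y" by auto
  then have "card (Y - X) = 1" using assms by (simp add: card_Diff_subset finite_subset)
  then obtain x where "Y - X = {x}" by (auto simp: card_1_singleton_iff)
  then show "X \<in> (\<lambda>y. Y - {y}) ` Y" using X by (intro image_eqI[of _ _ x]) auto
next
  fix X assume "X \<in> (\<lambda>y. Y - {y}) ` Y"
  then show "X \<in> {X. X \<subseteq> Y \<and> Suc (card X) = card Y}"
    using assms card_Suc_Diff1[OF assms] by auto
qed

lemma inj_on_remove: "inj_on (\<lambda>y. Y - {y}) Y"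
  by (auto simp: inj_on_def)

lemma card_lower_covers:
  assumes "finite Y"
  shows "card {X. X \<subseteq> Y \<and> Suc (card X) = card Y} = card Y"
  unfolding lower_covers_eq[OF assms] by (rule card_image[OF inj_on_remove])

text \<open>A set of size \<open>k < m\<close> has \<open>card V - k \<ge> k + 1\<close> upper
  covers, since \<open>2 * m \<le> card V + 1\<close>, and all of them lie in the up-set. A set of
  size \<open>k + 1\<close> has at most \<open>k + 1\<close> lower covers in \<open>P\<close>. Hence
  the degree is \<open>d k = Suc k\<close>.\<close>

lemma upset_antichain_push_up:
  assumes V: "finite V" and P: "P \<subseteq> Pow V"
    and upset: "\<And>X Y. X \<in> P \<Longrightarrow> X \<subseteq> Y \<Longrightarrow> Y \<subseteq> V \<Longrightarrow> Y \<in> P"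
    and m: "2 * m \<le> Suc (card V)"
    and G: "G \<subseteq> P" "antichain_wrt (\<subseteq>) G"
  shows "\<exists>G'. G' \<subseteq> P \<and> antichain_wrt (\<subseteq>) G' \<and> card G \<le> card G' \<and>
    (\<forall>X\<in>G'. m \<le> card X \<and> (card X = m \<or> X \<in> G))"
proof (rule antichain_push[where d = Suc])
  show "finite P" using V P by (meson finite_Pow_iff finite_subset)
  have fin: "finite X" if "X \<in> P" for X using that P V finite_subset by blast
  show "card X < card Y" if "X \<in> P" "Y \<in> P" "X \<subseteq> Y" "X \<noteq> Y" for X Y
    using that fin by (simp add: psubset_card_mono psubset_eq)
  show "Suc (card X) \<le> card {Y \<in> P. X \<subseteq> Y \<and> card Y = Suc (card X)}"
    if X: "X \<in> P" "card X < m" for X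
  proof -
    have "{Y \<in> P. X \<subseteq> Y \<and> card Y = Suc (card X)} = {Y. Y \<subseteq> V \<and> X \<subseteq> Y \<and> card Y = Suc (card X)}"
      using upset[OF X(1)] P by auto
    then show ?thesis using card_upper_covers[OF V, of X] X P m by auto
  qed
  show "card {X \<in> P. X \<subseteq> Y \<and> card X = k} \<le> Suc k" if Y: "Y \<in> P" "card Y = Suc k" for k Y
  proof -
    have "card {X \<in> P. X \<subseteq> Y \<and> card X = k} \<le> card {X. X \<subseteq> Y \<and> Suc (card X) = card Y}"
      by (rule card_mono) (use Y fin in auto)
    then show ?thesis using card_lower_covers[OF fin[OF Y(1)]] Y(2) by simp
  qed
qed (use G in auto)

text \<open>No member exceeds size \<open>t\<close>, so pushing up to level \<open>t\<close> places
  the whole antichain in that level.\<close>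

lemma card_antichain_bounded_size:
  assumes "finite V" "G \<subseteq> Pow V" "antichain_wrt (\<subseteq>) G" "2 * t \<le> Suc (card V)"
    and "\<And>X. X \<in> G \<Longrightarrow> card X \<le> t"
  shows "card G \<le> card V choose t"
proof -
  obtain G' where G': "G' \<subseteq> Pow V" "card G \<le> card G'"
    "\<And>X. X \<in> G' \<Longrightarrow> t \<le> card X \<and> (card X = t \<or> X \<in> G)"
    using upset_antichain_push_up[OF assms(1) subset_refl _ assms(4,2,3)] by auto
  have "G' \<subseteq> {X. X \<subseteq> V \<and> card X = t}" using G'(1,3) assms(5) by (force intro: antisym)
  then have "card G' \<le> card {X. X \<subseteq> V \<and> card X = t}" using assms(1) by (intro card_mono) auto
  then show ?thesis using G'(2) n_subsets[OF assms(1)] by simp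
qed

text \<open>Here \<open>m\<close> is a middle level. Pushing up stays in the complement of
  \<open>Pow T\<close> because this is an up-set. Pushing down may lose covers to
  \<open>Pow T\<close>, but never more than the slack in the degrees allows. In the end only
  \<open>m\<close>-subsets of \<open>V\<close> outside \<open>Pow T\<close> remain.\<close>

lemma card_antichain_not_below:
  assumes V: "finite V" and T: "T \<subseteq> V"
    and m: "2 * m \<le> Suc (card V)" "card V \<le> 2 * m"
    and G: "G \<subseteq> Pow V - Pow T" "antichain_wrt (\<subseteq>) G"
  shows "card G \<le> (card V choose m) - (card T choose m)"
proof -
  define N where "N = card V"
  define P where "P = Pow V - Pow T"
  have finP: "finite P" using V by (simp add: P_def)
  have sub: "X \<subseteq> V" "finite X" "card X \<le> N" if "X \<in> P" for X
    using that V finite_subset[of X V] card_mono[of V X] by (auto simp: P_def N_def)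
  have "\<exists>H. H \<subseteq> P \<and> antichain_wrt (\<subseteq>) H \<and> card G \<le> card H \<and>
    (\<forall>X\<in>H. m \<le> card X \<and> (card X = m \<or> X \<in> G))"
    by (rule upset_antichain_push_up[OF V _ _ m(1)]) (use G in \<open>auto simp: P_def\<close>)
  then obtain H where H: "H \<subseteq> P" "antichain_wrt (\<subseteq>) H" "card G \<le> card H"
    "\<And>X. X \<in> H \<Longrightarrow> m \<le> card X" by auto
  \<comment> \<open>The rank \<open>N - card X\<close> grows along reverse inclusion, so the same
    lemma now pushes downwards.\<close>
  have "\<exists>K. K \<subseteq> P \<and> antichain_wrt (\<lambda>X Y. Y \<subseteq> X) K \<and> card H \<le> card K \<and>
    (\<forall>X\<in>K. N - m \<le> N - card X \<and> (N - card X = N - m \<or> X \<in> H))"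
  proof (rule antichain_push[where d = Suc])
    show "N - card X < N - card Y" if "X \<in> P" "Y \<in> P" "Y \<subseteq> X" "X \<noteq> Y" for X Y
      using psubset_card_mono[of X Y] sub[of X] that by fastforce
    show "antichain_wrt (\<lambda>X Y. Y \<subseteq> X) H" using H(2) by (auto simp: antichain_wrt_def)
    \<comment> \<open>At most one of the lower covers \<open>X - {x}\<close> is a subset of \<open>T\<close>.\<close>
    show "Suc (N - card X) \<le> card {Y \<in> P. Y \<subseteq> X \<and> N - card Y = Suc (N - card X)}"
      if X: "X \<in> P" "N - card X < N - m" for X
    proof -
      obtain z where z: "z \<in> X" "z \<notin> T" using X by (auto simp: P_def)
      have "(\<lambda>y. X - {y}) ` (X - {z}) \<subseteq> {Y \<in> P. Y \<subseteq> X \<and> N - card Y = Suc (N - card X)}"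
      proof
        fix Y assume "Y \<in> (\<lambda>y. X - {y}) ` (X - {z})"
        then obtain y where y: "y \<in> X" "y \<noteq> z" "Y = X - {y}" by auto
        then have "Suc (card Y) = card X" using card_Suc_Diff1[OF sub(2)[OF X(1)]] by blast
        then show "Y \<in> {Y \<in> P. Y \<subseteq> X \<and> N - card Y = Suc (N - card X)}"
          using y z sub[OF X(1)] by (auto simp: P_def)
      qed
      then have "card ((\<lambda>y. X - {y}) ` (X - {z})) \<le>
          card {Y \<in> P. Y \<subseteq> X \<and> N - card Y = Suc (N - card X)}"
        using finP by (intro card_mono) auto
      moreover have "card ((\<lambda>y. X - {y}) ` (X - {z})) = card X - 1"
        using card_image[OF inj_on_subset[OF inj_on_remove[of X], of "X - {z}"]] z sub[OF X(1)]
        by simp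
      \<comment> \<open>From \<open>card X > m\<close> and \<open>N \<le> 2 * m\<close> follows
        \<open>card X - 1 \<ge> m \<ge> N - card X + 1\<close>.\<close>
      ultimately show ?thesis using X(2) m sub[OF X(1)] by (simp add: N_def)
    qed
    show "card {X \<in> P. Y \<subseteq> X \<and> N - card X = k} \<le> Suc k" if Y: "Y \<in> P" "N - card Y = Suc k" for k Y
    proof -
      have "card {X \<in> P. Y \<subseteq> X \<and> N - card X = k} \<le>
          card {X. X \<subseteq> V \<and> Y \<subseteq> X \<and> card X = Suc (card Y)}"
      proof (rule card_mono)
        show "{X \<in> P. Y \<subseteq> X \<and> N - card X = k} \<subseteq> {X. X \<subseteq> V \<and> Y \<subseteq> X \<and> card X = Suc (card Y)}"
          using Y sub by fastforce
      qed (use V in auto)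
      then show ?thesis using card_upper_covers[OF V sub(1)[OF Y(1)]] Y(2) by (simp add: N_def)
    qed
  qed (use finP H(1) in auto)
  then obtain K where K: "K \<subseteq> P" "card H \<le> card K"
    "\<And>X. X \<in> K \<Longrightarrow> N - m \<le> N - card X \<and> (N - card X = N - m \<or> X \<in> H)" by auto
  have mN: "card X = m" if "X \<in> K" for X
  proof (cases "X \<in> H")
    case True
    have "X \<in> P" using that K by blast
    then show ?thesis using H(4)[OF True] K(3)[OF that] sub(3)[of X] by linarith
  next
    case False
    have X: "X \<in> P" using that K by blast
    \<comment> \<open>Equality of the truncated differences gives \<open>card X = m\<close> only if
      \<open>m \<le> N\<close>. This follows from \<open>N > 0\<close>, and \<open>X\<close> is
      nonempty because it is not a subset of \<open>T\<close>.\<close>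
    then have "card X > 0" using sub(2)[OF X] by (auto simp: P_def card_gt_0_iff)
    then have "m \<le> N" using m sub(3)[OF X] by (simp add: N_def)
    then show ?thesis using False K(3)[OF that] sub(3)[OF X] by linarith
  qed
  have "K \<subseteq> {X. X \<subseteq> V \<and> card X = m} - {X. X \<subseteq> T \<and> card X = m}"
    using K(1) mN by (auto simp: P_def)
  then have "card K \<le> card ({X. X \<subseteq> V \<and> card X = m} - {X. X \<subseteq> T \<and> card X = m})"
    using V by (intro card_mono) auto
  also have "\<dots> = (card V choose m) - (card T choose m)"
    using T V finite_subset[OF T V] by (subst card_Diff_subset) (auto simp: n_subsets)
  finally show ?thesis using H(3) K(2) by linarith
qed

section \<open>The leaves of the tree\<close>

definition min_infeasible :: "nat \<Rightarrow> (nat \<Rightarrow> int) \<Rightarrow> int \<Rightarrow> nat set set" where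
  "min_infeasible n w C = {A. A \<subseteq> {1..n} \<and> C < sum w A \<and> (\<forall>x\<in>A. sum w (A - {x}) \<le> C)}"

definition max_feasible :: "nat \<Rightarrow> (nat \<Rightarrow> int) \<Rightarrow> int \<Rightarrow> nat set set" where
  "max_feasible n w C =
    {B. B \<subseteq> {1..n} \<and> sum w B \<le> C \<and> (\<forall>x\<in>{1..n} - B. C < sum w (insert x B))}"

text \<open>A maximal feasible set can be contained in a minimal infeasible one. The extra element
  \<open>Suc n\<close> removes this comparability.\<close>

definition leaf_family :: "nat \<Rightarrow> (nat \<Rightarrow> int) \<Rightarrow> int \<Rightarrow> nat set set" where
  "leaf_family n w C = min_infeasible n w C \<union> insert (Suc n) ` max_feasible n w C"

lemma leaf_family_subset: "leaf_family n w C \<subseteq> Pow {1..Suc n}"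
  by (auto simp: leaf_family_def min_infeasible_def max_feasible_def)

lemma finite_leaf_family: "finite (leaf_family n w C)"
  by (rule finite_subset[OF leaf_family_subset]) simp

text \<open>Since \<open>p\<close> is the lightest chosen item, removing any other item lowers the
  sum at least as much as removing \<open>p\<close>.\<close>

lemma min_infeasible_insert:
  assumes w: "antimono_on {1..n} w" and p: "p \<in> {1..n}" and J: "J \<subseteq> {1..<p}"
    and "sum w J \<le> C" "C < sum w (insert p J)"
  shows "insert p J \<in> min_infeasible n w C"
proof -
  have fin: "finite J" "p \<notin> J" using J finite_subset by auto
  have "sum w (insert p J - {x}) \<le> C" if x: "x \<in> insert p J" for x
  proof (cases "x = p")
    case True
    then show ?thesis using assms(4) fin by simp
  next
    case False
    then have "x \<in> J" using x by simp
    then have "w p \<le> w x" using w p J by (auto dest!: monotone_onD[of _ _ _ _ x p])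
    moreover have "sum w (insert p J - {x}) = sum w (insert p J) - w x"
      using x fin by (simp add: sum_diff1)
    ultimately show ?thesis using assms(4) fin by simp
  qed
  then show ?thesis using assms(5) p J by (auto simp: min_infeasible_def)
qed

text \<open>Dually, \<open>p\<close> is the lightest omitted item, so adding back any omitted item
  raises the sum at least as much as adding \<open>p\<close>.\<close>

lemma max_feasible_drop:
  assumes w: "antimono_on {1..n} w" and p: "p \<in> {1..n}" and J: "J \<subseteq> {1..<p}"
    and "sum w (J \<union> {p..n}) > C" "sum w (J \<union> {Suc p..n}) \<le> C"
  shows "J \<union> {Suc p..n} \<in> max_feasible n w C"
proof -
  let ?B = "J \<union> {Suc p..n}"
  have fin: "finite ?B" using J finite_subset by auto
  have "J \<union> {p..n} = insert p ?B" using p by auto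
  then have s: "sum w (J \<union> {p..n}) = w p + sum w ?B" using fin J by (simp only:) (subst sum.insert, auto)
  have max: "\<forall>x\<in>{1..n} - ?B. C < sum w (insert x ?B)"
  proof
    fix x assume x: "x \<in> {1..n} - ?B"
    have "x \<le> p" using x by auto
    then have "w p \<le> w x" using w p x by (auto dest!: monotone_onD[of _ _ _ _ x p])
    moreover have "sum w (insert x ?B) = w x + sum w ?B" using fin x by (intro sum.insert) auto
    ultimately show "C < sum w (insert x ?B)" using s assms(4) by simp
  qed
  have "?B \<subseteq> {1..n}" using p J by auto
  then show ?thesis unfolding max_feasible_def using assms(5) max by blast
qed

text \<open>The node has decided the variables before \<open>p\<close>, with ones \<open>J\<close>;
  its leaves correspond to members of the family with trace \<open>J\<close>. The traces of the two
  children split this class, so \<open>(2 a - 1) + (2 b - 1) + 1 = 2 (a + b) - 1\<close> drives the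
  induction. The last two premises are the invariant that a node which is a leaf yields a member of
  the family.\<close>

lemma node_count_less_leaves:
  assumes w: "antimono_on {1..n} w"
  shows "p \<le> Suc n \<Longrightarrow> 1 \<le> p \<Longrightarrow> J \<subseteq> {1..<p} \<Longrightarrow>
    (C < sum w J \<Longrightarrow> J \<in> min_infeasible n w C) \<Longrightarrow>
    (sum w (J \<union> {p..n}) \<le> C \<Longrightarrow> J \<union> {p..n} \<in> max_feasible n w C) \<Longrightarrow>
    node_count C (sum w {1..n} - C) (map (\<lambda>i. - w i) [p..<Suc n]) (sum w J) (sum w ({1..<p} - J))
      < 2 * card {X \<in> leaf_family n w C. X \<inter> {1..<p} = J}"
proof (induction "Suc n - p" arbitrary: p J)
  case 0
  then have p: "p = Suc n" by simp
  have "\<exists>X. X \<in> leaf_family n w C \<and> X \<inter> {1..<p} = J"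
  proof (cases "C < sum w J")
    case True
    then show ?thesis using 0 by (intro exI[of _ J]) (auto simp: leaf_family_def)
  next
    case False
    then show ?thesis using 0 p by (intro exI[of _ "insert (Suc n) J"]) (auto simp: leaf_family_def)
  qed
  then have "card {X \<in> leaf_family n w C. X \<inter> {1..<p} = J} > 0"
    using finite_leaf_family by (auto simp: card_gt_0_iff)
  then show ?case using p by simp
next
  case (Suc k)
  have p: "p \<in> {1..n}" using Suc.hyps(2) Suc.prems(2) by auto
  have J: "finite J" "p \<notin> J" using Suc.prems(3) finite_subset by auto
  let ?L = "\<lambda>p J. {X \<in> leaf_family n w C. X \<inter> {1..<p} = J}"
  have "{1..n} = ({1..<p} - J) \<union> (J \<union> {p..n})" using p Suc.prems(3) by auto
  then have "sum w {1..n} = sum w ({1..<p} - J) + sum w (J \<union> {p..n})"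
    using J by (simp only:) (rule sum.union_disjoint, auto)
  \<comment> \<open>The C1-condition says that the ones together with all free variables still
    fit.\<close>
  then have leaf1: "sum w ({1..<p} - J) \<ge> sum w {1..n} - C \<longleftrightarrow> sum w (J \<union> {p..n}) \<le> C" by linarith
  have list: "map (\<lambda>i. - w i) [p..<Suc n] = - w p # map (\<lambda>i. - w i) [Suc p..<Suc n]"
    using p by (subst upt_conv_Cons) auto
  show ?case
  proof (cases "C < sum w J \<or> sum w (J \<union> {p..n}) \<le> C")
    case True
    have "\<exists>X. X \<in> ?L p J"
    proof (cases "C < sum w J")
      case True
      then show ?thesis using Suc.prems by (intro exI[of _ J]) (auto simp: leaf_family_def)
    next
      case False
      then show ?thesis using True Suc.prems p
        by (intro exI[of _ "insert (Suc n) (J \<union> {p..n})"]) (auto simp: leaf_family_def)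
    qed
    then have "card (?L p J) > 0"
      using finite_leaf_family by (auto simp: card_gt_0_iff)
    then show ?thesis using True leaf1 by (subst node_count_leaf) auto
  next
    case False
    have I: "{1..<Suc p} - J = insert p ({1..<p} - J)" "{1..<Suc p} - insert p J = {1..<p} - J"
      using p J by auto
    \<comment> \<open>Fixing \<open>p\<close> to 0 keeps the sum of the ones, so only C1 can newly
      hold. Fixing it to 1 keeps the ones together with the free variables, so only C0 can.\<close>
    have z: "node_count C (sum w {1..n} - C) (map (\<lambda>i. - w i) [Suc p..<Suc n]) (sum w J)
        (sum w ({1..<Suc p} - J)) < 2 * card (?L (Suc p) J)"
      by (rule Suc.hyps(1))
        (use Suc.hyps(2) Suc.prems(3) False p max_feasible_drop[OF w p Suc.prems(3)] in auto)
    have eq: "insert p J \<union> {Suc p..n} = J \<union> {p..n}" using p by auto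
    have o: "node_count C (sum w {1..n} - C) (map (\<lambda>i. - w i) [Suc p..<Suc n]) (sum w (insert p J))
        (sum w ({1..<Suc p} - insert p J)) < 2 * card (?L (Suc p) (insert p J))"
    proof (rule Suc.hyps(1))
      show "insert p J \<union> {Suc p..n} \<in> max_feasible n w C"
        if "sum w (insert p J \<union> {Suc p..n}) \<le> C"
        using that False unfolding eq by simp
    qed (use Suc.hyps(2) Suc.prems(3) False p min_infeasible_insert[OF w p Suc.prems(3)] in auto)
    have "{1..<Suc p} = insert p {1..<p}" using p by auto
    then have "?L p J = ?L (Suc p) J \<union> ?L (Suc p) (insert p J)" using J by auto
    moreover have "?L (Suc p) J \<inter> ?L (Suc p) (insert p J) = {}" using J by auto
    ultimately have "card (?L p J) = card (?L (Suc p) J) + card (?L (Suc p) (insert p J))"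
      using finite_leaf_family by (simp add: card_Un_disjoint)
    moreover have "sum w ({1..<Suc p} - J) = sum w ({1..<p} - J) + w p"
      "sum w (insert p J) = sum w J + w p" unfolding I using J by auto
    ultimately show ?thesis using z o False leaf1 I(2) unfolding list by simp
  qed
qed

section \<open>From node counts to the MBnB complexity\<close>

lemma mbnb_complexity_eq_nodes:
  "mbnb_complexity n w C = subproblem_nodes n w C ({}, \<lambda>_. 0)"
proof -
  obtain inc where "(mbnb_step n w C ^^ mbnb_complexity n w C) ({#({}, \<lambda>_. 0)#}, None) ({#}, inc)"
    using mbnb_terminates_after_iff[of n w C] unfolding mbnb_terminates_after_def by blast
  from mbnb_run_length[OF this] show ?thesis by (simp add: wf_list_def list_nodes_def)
qed

text \<open>As the weights decrease, the sorted list of negated weights is the list in index order,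
  so the count for the root is the case \<open>p = 1\<close>, \<open>J = {}\<close>. The bounds on
  \<open>C\<close> make the root an inner node.\<close>

lemma mbnb_complexity_less_leaves:
  assumes w: "antimono_on {1..n} w" and C: "0 \<le> C" "C < sum w {1..n}"
  shows "mbnb_complexity n w C < 2 * card (leaf_family n w C)"
proof -
  have "sorted (map (\<lambda>i. - w i) [1..<Suc n])"
    unfolding sorted_map
  proof (rule sorted_wrt_mono_rel[OF _ sorted_upt])
    fix x y assume "x \<in> set [1..<Suc n]" "y \<in> set [1..<Suc n]" "x \<le> y"
    then show "- w x \<le> - w y" using w by (auto dest!: monotone_onD[of _ _ _ _ x y])
  qed
  then have "sorted_list_of_multiset (mset (map (\<lambda>i. - w i) [1..<Suc n]))
      = map (\<lambda>i. - w i) [1..<Suc n]"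
    by (simp only: sorted_list_of_multiset_mset sorted_sort_id)
  moreover have "mset (map (\<lambda>i. - w i) [1..<Suc n]) = image_mset (\<lambda>i. - w i) (mset_set {1..n})"
    by (metis mset_map mset_upt atLeastLessThanSuc_atLeastAtMost)
  ultimately have "mbnb_complexity n w C =
      node_count C (sum w {1..n} - C) (map (\<lambda>i. - w i) [1..<Suc n]) 0 0"
    by (simp add: mbnb_complexity_eq_nodes subproblem_nodes_def del: upt_Suc)
  then show ?thesis
    using node_count_less_leaves[OF w, of 1 "{}" C] C by simp
qed

section \<open>The leaf family is an antichain\<close>

lemma sum_weights_mono:
  fixes w :: "nat \<Rightarrow> int"
  assumes "\<And>i. i \<in> {1..n} \<Longrightarrow> w i > 0" "X \<subseteq> Y" "Y \<subseteq> {1..n}"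
  shows "sum w X \<le> sum w Y"
proof (rule sum_mono2)
  show "finite Y" using assms(3) finite_subset by blast
  show "0 \<le> w b" if "b \<in> Y - X" for b using assms(1)[of b] assms(3) that by auto
qed (rule assms(2))

text \<open>With positive weights, subsets of feasible sets are feasible. This gives minimality for
  pairs of infeasible sets, maximality for pairs of feasible sets, and excludes an infeasible set
  inside a feasible one; \<open>Suc n\<close> excludes the remaining mixed inclusion.\<close>

lemma leaf_family_antichain:
  assumes pos: "\<And>i. i \<in> {1..n} \<Longrightarrow> w i > 0"
  shows "antichain_wrt (\<subseteq>) (leaf_family n w C)"
proof -
  have mono: "sum w X \<le> sum w Y" if "X \<subseteq> Y" "Y \<subseteq> {1..n}" for X Y
    using sum_weights_mono[OF pos that] .
  have AA: "A = A'"
    if A: "A \<in> min_infeasible n w C" "A' \<in> min_infeasible n w C" "A \<subseteq> A'" for A A'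
  proof (rule ccontr)
    assume "A \<noteq> A'"
    then obtain x where x: "x \<in> A'" "A \<subseteq> A' - {x}" using A(3) by blast
    then have "sum w A \<le> sum w (A' - {x})" using A by (intro mono) (auto simp: min_infeasible_def)
    then show False using A x by (fastforce simp: min_infeasible_def)
  qed
  have BB: "B = B'"
    if B: "B \<in> max_feasible n w C" "B' \<in> max_feasible n w C" "B \<subseteq> B'" for B B'
  proof (rule ccontr)
    assume "B \<noteq> B'"
    then obtain x where x: "x \<in> B' - B" "insert x B \<subseteq> B'" using B(3) by blast
    then have "sum w (insert x B) \<le> sum w B'"
      using B by (intro mono) (auto simp: max_feasible_def)
    moreover have "x \<in> {1..n} - B" using x B by (auto simp: max_feasible_def)
    then have "C < sum w (insert x B)" using B by (simp add: max_feasible_def)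
    moreover have "sum w B' \<le> C" using B by (simp add: max_feasible_def)
    ultimately show False by linarith
  qed
  have AB: "\<not> A \<subseteq> B" if "A \<in> min_infeasible n w C" "B \<in> max_feasible n w C" for A B
    using that mono[of A B] by (auto simp: min_infeasible_def max_feasible_def)
  have n: "Suc n \<notin> X" if "X \<in> min_infeasible n w C \<or> X \<in> max_feasible n w C" for X
    using that by (auto simp: min_infeasible_def max_feasible_def)
  show ?thesis
    unfolding antichain_wrt_def leaf_family_def
  proof (intro ballI impI)
    fix X Y
    assume X: "X \<in> min_infeasible n w C \<union> insert (Suc n) ` max_feasible n w C"
      and Y: "Y \<in> min_infeasible n w C \<union> insert (Suc n) ` max_feasible n w C" and le: "X \<subseteq> Y"
    from X show "X = Y"
    proof
      assume X': "X \<in> min_infeasible n w C"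
      have "Y \<in> min_infeasible n w C"
      proof (rule ccontr)
        assume "Y \<notin> min_infeasible n w C"
        then obtain B where "B \<in> max_feasible n w C" "Y = insert (Suc n) B" using Y by blast
        then show False using AB[OF X', of B] n[of X] X' le by blast
      qed
      then show ?thesis using AA X' le by blast
    next
      assume "X \<in> insert (Suc n) ` max_feasible n w C"
      then obtain B where B: "B \<in> max_feasible n w C" "X = insert (Suc n) B" by blast
      then have "Y \<notin> min_infeasible n w C" using n[of Y] le by blast
      then obtain B' where B': "B' \<in> max_feasible n w C" "Y = insert (Suc n) B'" using Y by blast
      then have "B \<subseteq> B'" using B le n[of B] by blast
      then show ?thesis using BB B B' by blast
    qed
  qed
qed

section \<open>The role of \<open>t\<close>\<close>

text \<open>Exchange argument: \<open>?T - X\<close> and \<open>X - ?T\<close> have equal size, and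
  the weight \<open>?c\<close> at the boundary index bounds the former's weights from above and the
  latter's from below.\<close>

lemma sum_smallest_le:
  fixes w :: "nat \<Rightarrow> int"
  assumes w: "antimono_on {1..n} w" and X: "X \<subseteq> {1..n}" "card X = k" and k: "1 \<le> k"
  shows "sum w {n - k + 1..n} \<le> sum w X"
proof -
  let ?T = "{n - k + 1..n}"
  have fin: "finite X" using X finite_subset by blast
  have kn: "k \<le> n" using card_mono[OF _ X(1)] X(2) by simp
  then have cT: "card ?T = k" by simp
  let ?c = "w (n - k + 1)"
  have "card (?T - X) = card (X - ?T)"
    using card_Diff_subset_Int[of ?T X] card_Diff_subset_Int[of X ?T] fin cT X(2)
    by (simp add: Int_commute)
  moreover have "sum w (?T - X) \<le> of_nat (card (?T - X)) * ?c"
    by (rule sum_bounded_above) (use kn k in \<open>auto intro!: monotone_onD[OF w]\<close>)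
  moreover have "of_nat (card (X - ?T)) * ?c \<le> sum w (X - ?T)"
    by (rule sum_bounded_below) (use kn k X in \<open>auto intro!: monotone_onD[OF w]\<close>)
  ultimately have "sum w (?T - X) \<le> sum w (X - ?T)" by simp
  moreover have "sum w ?T = sum w (?T \<inter> X) + sum w (?T - X)"
    by (rule sum.Int_Diff) simp
  moreover have "sum w X = sum w (X \<inter> ?T) + sum w (X - ?T)"
    by (rule sum.Int_Diff[OF fin])
  ultimately show ?thesis by (simp add: Int_commute)
qed

lemma mbnb_t_props:
  assumes C: "0 \<le> C" "C < sum w {1..n}"
  shows "mbnb_t n w C \<in> {1..n}" and "C < sum w {n - mbnb_t n w C + 1..n}"
    and "sum w {n - mbnb_t n w C + 2..n} \<le> C"
proof -
  let ?K = "{k \<in> {1..n}. sum w {n - k + 1..n} > C}"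
  let ?t = "mbnb_t n w C"
  have "1 \<le> n" using C by (cases n) auto
  then have "n \<in> ?K" using C by simp
  then have "Min ?K \<in> ?K" by (intro Min_in) auto
  then have t: "?t \<in> ?K" unfolding mbnb_t_def .
  then show "?t \<in> {1..n}" "C < sum w {n - ?t + 1..n}" by auto
  show "sum w {n - ?t + 2..n} \<le> C"
  proof (cases "?t = 1")
    \<comment> \<open>For \<open>t = 1\<close> the interval is empty, and its sum 0 is at most
      \<open>C\<close>.\<close>
    case True
    then show ?thesis using C t by simp
  next
    case False
    have "?t - 1 \<notin> ?K"
    proof
      assume "?t - 1 \<in> ?K"
      then have "?t \<le> ?t - 1" unfolding mbnb_t_def by (intro Min_le) auto
      then show False using t by auto
    qed
    moreover have "n - (?t - 1) + 1 = n - ?t + 2" using t False by auto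
    ultimately show ?thesis using t False by auto
  qed
qed

text \<open>Any \<open>t\<close> items exceed \<open>C\<close>, because the \<open>t\<close>
  lightest do. So a minimal infeasible set has at most \<open>t\<close> elements and a maximal
  feasible set fewer than \<open>t\<close>, which leaves room for \<open>Suc n\<close>.\<close>

lemma card_leaf_le:
  assumes pos: "\<And>i. i \<in> {1..n} \<Longrightarrow> w i > 0" and w: "antimono_on {1..n} w"
    and C: "0 \<le> C" "C < sum w {1..n}" and X: "X \<in> leaf_family n w C"
  shows "card X \<le> mbnb_t n w C"
proof -
  let ?t = "mbnb_t n w C"
  have big: "C < sum w Y" if Y: "Y \<subseteq> {1..n}" "?t \<le> card Y" for Y
  proof -
    obtain Z where Z: "Z \<subseteq> Y" "card Z = ?t" using obtain_subset_with_card_n[OF Y(2)] by blast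
    then have "sum w {n - ?t + 1..n} \<le> sum w Z"
      using sum_smallest_le[OF w] Y mbnb_t_props(1)[OF C] by auto
    also have "\<dots> \<le> sum w Y"
      by (rule sum_weights_mono[OF pos Z(1) Y(1)])
    finally show ?thesis using mbnb_t_props(2)[OF C] by simp
  qed
  show ?thesis
  proof (cases "X \<in> min_infeasible n w C")
    case True
    show ?thesis
    proof (rule ccontr)
      assume less: "\<not> card X \<le> ?t"
      then obtain x where x: "x \<in> X" by fastforce
      have "finite X" using less card.infinite by fastforce
      then have "?t \<le> card (X - {x})" using x less by simp
      then have "C < sum w (X - {x})" using True by (intro big) (auto simp: min_infeasible_def)
      then show False using True x by (fastforce simp: min_infeasible_def)
    qed
  next
    case False
    then obtain B where B: "B \<in> max_feasible n w C" "X = insert (Suc n) B"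
      using X by (auto simp: leaf_family_def)
    then have "card B < ?t" using big[of B] by (force simp: max_feasible_def)
    then show ?thesis using B card_insert_le_m1[of ?t B "Suc n"] mbnb_t_props(1)[OF C] by auto
  qed
qed

text \<open>Every subset of \<open>{k..n}\<close> is feasible, so \<open>X\<close> comes from a
  maximal feasible set within \<open>{k..n}\<close>, and maximality makes that set all of
  \<open>{k..n}\<close>.\<close>

lemma leaf_family_below:
  assumes pos: "\<And>i. i \<in> {1..n} \<Longrightarrow> w i > 0"
    and k: "1 \<le> k" "k \<le> Suc n" and feasible: "sum w {k..n} \<le> C"
    and X: "X \<in> leaf_family n w C" "X \<subseteq> {k..Suc n}"
  shows "X = {k..Suc n}"
proof -
  have sub: "sum w Y \<le> C" if "Y \<subseteq> {k..n}" for Y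
  proof -
    have "sum w Y \<le> sum w {k..n}"
      using that k by (intro sum_weights_mono[OF pos]) auto
    then show ?thesis using feasible by simp
  qed
  have le: "Y \<subseteq> {k..n}" if "Y \<subseteq> {1..n}" "Y \<subseteq> {k..Suc n}" for Y
    using that by fastforce
  have "X \<notin> min_infeasible n w C"
    using sub[of X] le[of X] X(2) by (auto simp: min_infeasible_def)
  then obtain B where B: "B \<in> max_feasible n w C" "X = insert (Suc n) B"
    using X(1) by (auto simp: leaf_family_def)
  then have "B \<subseteq> {k..n}" using X(2) by (intro le) (auto simp: max_feasible_def)
  moreover have "{k..n} \<subseteq> B"
  proof
    fix x assume x: "x \<in> {k..n}"
    then have "sum w (insert x B) \<le> C" using sub \<open>B \<subseteq> {k..n}\<close> by simp
    moreover have "C < sum w (insert x B)" if "x \<notin> B"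
      using B(1) x k that by (simp add: max_feasible_def)
    ultimately show "x \<in> B" by linarith
  qed
  ultimately show ?thesis using B(2) k by auto
qed

theorem theorem3:
  fixes n t :: nat and w :: "nat \<Rightarrow> int" and C :: int
  assumes "C > 0"
    and "\<And>i. i \<in> {1..n} \<Longrightarrow> w i > 0"
    and "antimono_on {1..n} w"
    and "(\<Sum>i=1..n. w i) > C"
    and "t = mbnb_t n w C"
  shows "(t \<le> n div 2 + 1 \<longrightarrow>
           int (mbnb_complexity n w C) \<le> 2 * int ((n + 1) choose t) - 1) \<and>
         (t > n div 2 + 1 \<longrightarrow>
           int (mbnb_complexity n w C) \<le>
             2 * (int ((n + 1) choose (n div 2 + 1)) - int (t choose (n div 2 + 1))) + 1)"
proof -
  have C: "0 \<le> C" "C < sum w {1..n}" using assms by auto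
  let ?F = "leaf_family n w C"
  let ?m = "n div 2 + 1"
  have S: "mbnb_complexity n w C < 2 * card ?F"
    by (rule mbnb_complexity_less_leaves[OF assms(3) C])
  have anti: "antichain_wrt (\<subseteq>) ?F" by (rule leaf_family_antichain[OF assms(2)])
  have "int (mbnb_complexity n w C) \<le> 2 * int ((n + 1) choose t) - 1" if "t \<le> ?m"
  proof -
    \<comment> \<open>The condition \<open>2 * t \<le> n + 2\<close> follows from
      \<open>t \<le> n div 2 + 1\<close>.\<close>
    have "card ?F \<le> card {1..Suc n} choose t"
      by (rule card_antichain_bounded_size[OF _ leaf_family_subset anti])
        (use that card_leaf_le[OF assms(2,3) C] assms(5) in auto)
    then show ?thesis using S by simp
  qed
  moreover have "int (mbnb_complexity n w C) \<le>
      2 * (int ((n + 1) choose ?m) - int (t choose ?m)) + 1"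
  proof -
    let ?T = "{n - t + 2..Suc n}"
    have t: "t \<in> {1..n}" "sum w {n - t + 2..n} \<le> C"
      using mbnb_t_props[OF C] assms(5) by auto
    \<comment> \<open>For either parity of \<open>n\<close>, \<open>2 * ?m\<close> is
      \<open>n + 1\<close> or \<open>n + 2\<close>, so \<open>?m\<close> is a middle level of the
      subsets of \<open>{1..Suc n}\<close>.\<close>
    have "card (?F - {?T}) \<le> (card {1..Suc n} choose ?m) - (card ?T choose ?m)"
    proof (rule card_antichain_not_below)
      show "?F - {?T} \<subseteq> Pow {1..Suc n} - Pow ?T"
        using leaf_family_subset[of n w C] leaf_family_below[OF assms(2) _ _ t(2)] t(1) by fastforce
      show "antichain_wrt (\<subseteq>) (?F - {?T})" using anti by (auto simp: antichain_wrt_def)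
    qed auto
    moreover have "card ?T = t" "card {1..Suc n} = n + 1" using t by auto
    moreover have "t choose ?m \<le> (n + 1) choose ?m"
      using t by (intro binomial_right_mono) auto
    ultimately have "card (?F - {?T}) + (t choose ?m) \<le> (n + 1) choose ?m"
      by (simp only: le_diff_conv2)
    \<comment> \<open>Setting \<open>?T\<close> aside costs at most one leaf, that is two nodes,
      which turns the summand -1 into +1.\<close>
    moreover have "card ?F \<le> card (?F - {?T}) + 1"
      using diff_card_le_card_Diff[of "{?T}" ?F] by simp
    ultimately have "mbnb_complexity n w C + 2 * (t choose ?m) \<le> 2 * ((n + 1) choose ?m) + 1"
      using S by linarith
    then have "int (mbnb_complexity n w C) + 2 * int (t choose ?m) \<le> 2 * int ((n + 1) choose ?m) + 1"
      unfolding of_nat_le_iff[where 'a = int, symmetric] by (simp only: of_nat_simps of_nat_numeral)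
    then show ?thesis by (simp only: right_diff_distrib)
  qed
  ultimately show ?thesis by blast
qed

end
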